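(* Let $(H,\tilde u)$, functions of $(t,x,\lambda)$ with $t\in(0,T)$, $x\in\mathbb{R}$, $\lambda\in I=(0,1)$, be a regular enough solution of $$\partial_tH+\partial_x(H\tilde u)=0,\qquad \partial_t\tilde u+\tilde u\,\partial_x\tilde u+g\,\partial_x\int_0^1H\,\mathrm{d}\lambda=0 .$$ Let $c=c(t,x)\in\sigma_p(A_0)$ be a solution of $$\int_0^1\frac{gH(t,x,\lambda)}{(c(t,x)-\tilde u(t,x,\lambda))^2}\,\mathrm{d}\lambda=1 .$$ Then the relation $$\frac{\partial}{\partial t}\left(c-g\int_0^1\frac{H}{\tilde u-c}\,\mathrm{d}\lambda\right)+c\,\frac{\partial}{\partial x}\left(c-g\int_0^1\frac{H}{\tilde u-c}\,\mathrm{d}\lambda\right)=0$$ holds, i.e. the quantity $\tilde r=\tilde r(t,x)=c-g\int_0^1\frac{H}{\tilde u-c}\,\mathrm{d}\lambda$ is a generalized Riemann invariant associated to the eigenvalue $c=c(t,x)$.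
   Context: $g>0$ is the gravity constant. For each $(t,x)$, $A_0$ is the operator on $L^2(I)^2$ given by $A_0(\phi_1,\phi_2)=(\tilde u\phi_1+H\phi_2,\ g\int_0^1\phi_1\,\mathrm{d}\lambda+\tilde u\phi_2)$, with $\tilde u=\tilde u(t,x,\cdot)$, $H=H(t,x,\cdot)$, and $\sigma_p(A_0)$ is its point spectrum, i.e. the set of $c$ such that $A_0-c\mathbf{I}$ is not injective. A generalized Riemann invariant associated to $c(t,x)$ is any function $R(t,x)$ satisfying $\partial_tR+c\,\partial_xR=0$. Standing regularity: $(H,\tilde u)$ and $c$ are smooth enough (e.g. $C^1$, with $c(t,x)$ away from the range of $\tilde u(t,x,\cdot)$) for the derivatives and integrals to make sense and for differentiation under the integral. *)

theory Defs
  imports "HOL-Analysis.Analysis"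
begin

abbreviation I01 :: "real set" where
  "I01 \<equiv> {0<..<1}"

abbreviation int01 :: "(real \<Rightarrow> 'a::{banach, second_countable_topology}) \<Rightarrow> 'a" where
  "int01 f \<equiv> integral\<^sup>L (lebesgue_on I01) f"

text \<open>The eigenvalue \<open>c\<close> may a priori be complex, so \<open>L\<^sup>2(I)\<close> is taken over the complex numbers.
  Elements are represented by functions; equality in \<open>L\<^sup>2(I)\<^sup>2\<close> is almost-everywhere equality
  of representatives, expressed by \<open>ae_eq\<close>.\<close>

definition L2_I :: "(real \<Rightarrow> complex) set" where
  "L2_I = {\<phi> \<in> borel_measurable (lebesgue_on I01).
             integrable (lebesgue_on I01) (\<lambda>l. (cmod (\<phi> l))\<^sup>2)}"

type_synonym fun_pair = "(real \<Rightarrow> complex) \<times> (real \<Rightarrow> complex)"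

definition ae_eq :: "fun_pair \<Rightarrow> fun_pair \<Rightarrow> bool" where
  "ae_eq \<phi> \<psi> \<longleftrightarrow>
     (AE l in lebesgue_on I01. fst \<phi> l = fst \<psi> l \<and> snd \<phi> l = snd \<psi> l)"

text \<open>The arguments \<open>h\<close> and \<open>v\<close> are the profiles \<open>H(t,x,\<cdot>)\<close> and \<open>u(t,x,\<cdot>)\<close> at a fixed \<open>(t,x)\<close>.\<close>

definition A0 :: "real \<Rightarrow> (real \<Rightarrow> real) \<Rightarrow> (real \<Rightarrow> real) \<Rightarrow> fun_pair \<Rightarrow> fun_pair" where
  "A0 g h v \<phi> =
     (\<lambda>l. of_real (v l) * fst \<phi> l + of_real (h l) * snd \<phi> l,
      \<lambda>l. of_real g * int01 (fst \<phi>) + of_real (v l) * snd \<phi> l)"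

definition A0_shift ::
  "real \<Rightarrow> (real \<Rightarrow> real) \<Rightarrow> (real \<Rightarrow> real) \<Rightarrow> complex \<Rightarrow> fun_pair \<Rightarrow> fun_pair" where
  "A0_shift g h v c \<phi> =
     (\<lambda>l. fst (A0 g h v \<phi>) l - c * fst \<phi> l,
      \<lambda>l. snd (A0 g h v \<phi>) l - c * snd \<phi> l)"

definition point_spectrum_A0 :: "real \<Rightarrow> (real \<Rightarrow> real) \<Rightarrow> (real \<Rightarrow> real) \<Rightarrow> complex set" where
  "point_spectrum_A0 g h v =
     {c. \<not> (\<forall>\<phi> \<in> L2_I \<times> L2_I. \<forall>\<psi> \<in> L2_I \<times> L2_I.
            ae_eq (A0_shift g h v c \<phi>) (A0_shift g h v c \<psi>) \<longrightarrow> ae_eq \<phi> \<psi>)}"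

definition C1_strip :: "real \<Rightarrow> (real \<Rightarrow> real \<Rightarrow> 'a::real_normed_vector) \<Rightarrow> bool" where
  "C1_strip T f \<longleftrightarrow>
     (\<forall>t\<in>{0<..<T}. \<forall>x. (\<lambda>s. f s x) differentiable (at t) \<and> (\<lambda>y. f t y) differentiable (at x)) \<and>
     continuous_on ({0<..<T} \<times> UNIV) (\<lambda>(t, x). vector_derivative (\<lambda>s. f s x) (at t)) \<and>
     continuous_on ({0<..<T} \<times> UNIV) (\<lambda>(t, x). vector_derivative (\<lambda>y. f t y) (at x))"

text \<open>Regularity of \<open>H\<close> and \<open>u\<close>: \<open>C\<^sup>1\<close> in \<open>(t,x)\<close>, measurable in \<open>\<lambda>\<close>, and, together with the
  first derivatives in \<open>(t,x)\<close>, bounded uniformly in \<open>\<lambda>\<close> and locally uniformly in \<open>(t,x)\<close>.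
  No continuity in \<open>\<lambda>\<close> is required. Functions that are \<open>C\<^sup>1\<close> up to the closed interval
  \<open>[0,1]\<close> in \<open>\<lambda>\<close> are covered, and \<open>H(t,x,\<cdot>)\<close>, \<open>u(t,x,\<cdot>)\<close> are bounded, so that \<open>A0\<close>
  maps \<open>L\<^sup>2(I)\<^sup>2\<close> to itself.\<close>

definition regular_field :: "real \<Rightarrow> (real \<Rightarrow> real \<Rightarrow> real \<Rightarrow> real) \<Rightarrow> bool" where
  "regular_field T f \<longleftrightarrow>
     (\<forall>l\<in>I01. C1_strip T (\<lambda>t x. f t x l)) \<and>
     (\<forall>t\<in>{0<..<T}. \<forall>x. f t x \<in> borel_measurable (lebesgue_on I01)) \<and>
     (\<forall>K. compact K \<and> K \<subseteq> {0<..<T} \<times> UNIV \<longrightarrow>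
        (\<exists>B. \<forall>(t, x)\<in>K. \<forall>l\<in>I01.
           \<bar>f t x l\<bar> \<le> B \<and> \<bar>deriv (\<lambda>s. f s x l) t\<bar> \<le> B \<and> \<bar>deriv (\<lambda>y. f t y l) x\<bar> \<le> B))"

definition solves_system ::
  "real \<Rightarrow> real \<Rightarrow> (real \<Rightarrow> real \<Rightarrow> real \<Rightarrow> real) \<Rightarrow> (real \<Rightarrow> real \<Rightarrow> real \<Rightarrow> real) \<Rightarrow> bool" where
  "solves_system g T H u \<longleftrightarrow>
     (\<forall>t\<in>{0<..<T}. \<forall>x. \<forall>l\<in>I01.
        deriv (\<lambda>s. H s x l) t + deriv (\<lambda>y. H t y l * u t y l) x = 0 \<and>
        deriv (\<lambda>s. u s x l) t + u t x l * deriv (\<lambda>y. u t y l) x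
          + g * deriv (\<lambda>y. int01 (H t y)) x = 0)"

text \<open>Differentiability is part of the notion, since \<open>vector_derivative\<close> is an arbitrary value
  where the derivative does not exist.\<close>

definition generalized_Riemann_invariant ::
  "real \<Rightarrow> (real \<Rightarrow> real \<Rightarrow> complex) \<Rightarrow> (real \<Rightarrow> real \<Rightarrow> complex) \<Rightarrow> bool" where
  "generalized_Riemann_invariant T c R \<longleftrightarrow>
     (\<forall>t\<in>{0<..<T}. \<forall>x.
        (\<lambda>s. R s x) differentiable (at t) \<and> (\<lambda>y. R t y) differentiable (at x) \<and>
        vector_derivative (\<lambda>s. R s x) (at t)
          + c t x * vector_derivative (\<lambda>y. R t y) (at x) = 0)"

end

theory Submission
  imports Defs "HOL-Real_Asymp.Real_Asymp"
begin

text \<open>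
  Write \<open>r = c - g \<integral> H / (u - c)\<close>. Differentiating under the integral, the terms carrying a derivative
  of \<open>c\<close> cancel because \<open>g \<integral> H / (u - c)\<^sup>2 = 1\<close>, so that a derivative of \<open>r\<close> is
  \<open>- g \<integral> (H' / (u - c) - H u' / (u - c)\<^sup>2)\<close>. In \<open>r\<^sub>t + c r\<^sub>x\<close> the system gives
  \<open>H\<^sub>t + c H\<^sub>x = - (u - c) H\<^sub>x - H u\<^sub>x\<close> and \<open>u\<^sub>t + c u\<^sub>x = - (u - c) u\<^sub>x - g P\<close> with
  \<open>P = \<integral> H\<^sub>x\<close>; the terms in \<open>u\<^sub>x\<close> cancel pointwise and \<open>g (P - P g \<integral> H / (u - c)\<^sup>2) = 0\<close> remains.
  Differentiation under the integral is by dominated convergence: \<open>u\<close> and \<open>c\<close> are locally Lipschitz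
  uniformly in \<open>\<lambda>\<close>, so \<open>u - c\<close> stays bounded away from \<open>0\<close> near each point.
\<close>

section \<open>Differentiation under the integral sign\<close>

text \<open>Difference quotients express a derivative as a plain limit, which can be tested along
  sequences; that is the form in which dominated convergence applies.\<close>

lemma has_vector_derivative_iff_quotient:
  fixes f :: "real \<Rightarrow> 'b::real_normed_vector"
  shows "(f has_vector_derivative D) (at x within S) \<longleftrightarrow>
    ((\<lambda>y. (f y - f x) /\<^sub>R (y - x)) \<longlongrightarrow> D) (at x within S)"
proof -
  have eq: "norm (f y - f x - (y - x) *\<^sub>R D) / norm (y - x) = norm ((f y - f x) /\<^sub>R (y - x) - D)"
    if "y \<noteq> x" for y
  proof -
    have "(f y - f x) /\<^sub>R (y - x) - D = (f y - f x - (y - x) *\<^sub>R D) /\<^sub>R (y - x)"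
      using that by (simp add: scaleR_diff_right)
    then show ?thesis
      by (simp add: divide_inverse)
  qed
  have "(f has_vector_derivative D) (at x within S) \<longleftrightarrow>
    ((\<lambda>y. norm (f y - f x - (y - x) *\<^sub>R D) / norm (y - x)) \<longlongrightarrow> 0) (at x within S)"
    by (simp add: has_vector_derivative_def has_derivative_iff_norm bounded_linear_scaleR_left)
  also have "\<dots> \<longleftrightarrow> ((\<lambda>y. norm ((f y - f x) /\<^sub>R (y - x) - D)) \<longlongrightarrow> 0) (at x within S)"
    by (intro filterlim_cong refl) (simp add: eventually_at_filter eq del: real_norm_def)
  also have "\<dots> \<longleftrightarrow> ((\<lambda>y. (f y - f x) /\<^sub>R (y - x)) \<longlongrightarrow> D) (at x within S)"
    by (simp add: tendsto_norm_zero_iff LIM_zero_iff)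
  finally show ?thesis .
qed

lemma norm_diff_le_of_vector_derivative_bound:
  fixes f :: "real \<Rightarrow> 'b::real_normed_vector"
  assumes "convex S"
    and "\<And>s. s \<in> S \<Longrightarrow> (f has_vector_derivative f' s) (at s)"
    and "\<And>s. s \<in> S \<Longrightarrow> norm (f' s) \<le> B"
    and "a \<in> S" and "b \<in> S"
  shows "norm (f b - f a) \<le> B * \<bar>b - a\<bar>"
proof -
  have "onorm (\<lambda>h. h *\<^sub>R f' s) \<le> B" if "s \<in> S" for s
    by (rule onorm_le) (use assms(3)[OF that] in \<open>simp add: mult.commute[of B] mult_left_mono\<close>)
  then show ?thesis
    using differentiable_bound[of S f "\<lambda>s h. h *\<^sub>R f' s" B b a] assms
    by (auto simp: has_vector_derivative_def has_derivative_at_withinI)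
qed

text \<open>By the mean value inequality \<open>w\<close> dominates the difference quotients as well
  as \<open>F'\<close>, so dominated convergence applies along every sequence tending to
  \<open>t\<close>. Measurability of \<open>F' t\<close> is not assumed: it is a pointwise limit of
  measurable quotients.\<close>

lemma leibniz_rule_dominated:
  fixes F F' :: "real \<Rightarrow> 'a \<Rightarrow> 'b::{banach, second_countable_topology}"
  assumes d: "0 < d"
    and F: "\<And>s. s \<in> ball t d \<Longrightarrow> integrable M (F s)"
    and F': "\<And>s l. s \<in> ball t d \<Longrightarrow> l \<in> space M \<Longrightarrow>
      ((\<lambda>s. F s l) has_vector_derivative F' s l) (at s)"
    and w: "integrable M w"
    and bound: "\<And>s l. s \<in> ball t d \<Longrightarrow> l \<in> space M \<Longrightarrow> norm (F' s l) \<le> w l"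
  shows "integrable M (F' t)"
    and "((\<lambda>s. integral\<^sup>L M (F s)) has_vector_derivative integral\<^sup>L M (F' t)) (at t)"
proof -
  define Q where "Q s l = (F s l - F t l) /\<^sub>R (s - t)" for s l
  have t: "t \<in> ball t d"
    using d by simp
  have Q_int: "integrable M (Q s)" if "s \<in> ball t d" for s
    unfolding Q_def using F[OF that] F[OF t] by simp
  have Q_bound: "norm (Q s l) \<le> w l" if "s \<in> ball t d" "s \<noteq> t" "l \<in> space M" for s l
  proof -
    have "norm (F s l - F t l) \<le> w l * \<bar>s - t\<bar>"
      by (rule norm_diff_le_of_vector_derivative_bound[where S = "ball t d"
            and f = "\<lambda>s. F s l" and f' = "\<lambda>s. F' s l"])
        (use that F' bound d in auto)
    then show ?thesis
      using that by (simp add: Q_def pos_divide_le_eq flip: divide_inverse_commute)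
  qed
  have Q_lim: "(\<lambda>n. Q (X n) l) \<longlonglongrightarrow> F' t l"
    if "\<And>n. X n \<in> ball t d - {t}" "X \<longlonglongrightarrow> t" "l \<in> space M" for X l
  proof -
    have "((\<lambda>s. Q s l) \<longlongrightarrow> F' t l) (at t within ball t d)"
      using has_vector_derivative_at_within[OF F'[OF t \<open>l \<in> space M\<close>]]
      unfolding Q_def has_vector_derivative_iff_quotient .
    then show ?thesis
      using that unfolding tendsto_at_iff_sequentially by (auto simp: o_def)
  qed
  have meas: "F' t \<in> borel_measurable M"
  proof (rule borel_measurable_LIMSEQ_metric)
    \<comment> \<open>Any sequence in the punctured ball tending to \<open>t\<close> serves here;
      the offset 2 keeps already \<open>X 0 = t + d / 2\<close> inside the open ball.\<close>
    define X where "X n = t + d / (real n + 2)" for n :: nat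
    have X: "X n \<in> ball t d - {t}" for n
      using d by (auto simp: X_def dist_real_def field_simps add_pos_nonneg)
    have "X \<longlonglongrightarrow> t"
      unfolding X_def by real_asymp
    then show "(\<lambda>n. Q (X n) l) \<longlonglongrightarrow> F' t l" if "l \<in> space M" for l
      using Q_lim[of X l] X that by blast
    show "Q (X n) \<in> borel_measurable M" for n
      using Q_int[of "X n"] X[of n] by auto
  qed
  show "integrable M (F' t)"
    by (rule Bochner_Integration.integrable_bound[OF w meas])
      (rule AE_I2, use bound[OF t] in \<open>fastforce intro: order_trans[OF _ abs_ge_self]\<close>)
  \<comment> \<open>The limit is taken within \<open>ball t d\<close> so that all test sequences
    stay where the hypotheses hold. As the ball is open, it agrees with the limit at
    \<open>t\<close>.\<close>
  have "((\<lambda>s. (integral\<^sup>L M (F s) - integral\<^sup>L M (F t)) /\<^sub>R (s - t)) \<longlongrightarrow> integral\<^sup>L M (F' t))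
    (at t within ball t d)"
    unfolding tendsto_at_iff_sequentially o_def
  proof (intro allI impI)
    fix X :: "nat \<Rightarrow> real"
    assume X: "\<forall>n. X n \<in> ball t d - {t}" "X \<longlonglongrightarrow> t"
    have "(\<lambda>n. integral\<^sup>L M (Q (X n))) \<longlonglongrightarrow> integral\<^sup>L M (F' t)"
    proof (rule integral_dominated_convergence[OF meas _ w])
      show "Q (X n) \<in> borel_measurable M" for n
        using Q_int[of "X n"] X by auto
      show "AE l in M. (\<lambda>n. Q (X n) l) \<longlonglongrightarrow> F' t l"
        using Q_lim X by (intro AE_I2) blast
      show "AE l in M. norm (Q (X n) l) \<le> w l" for n
        using Q_bound X by (intro AE_I2) blast
    qed
    moreover have "integral\<^sup>L M (Q (X n)) = (integral\<^sup>L M (F (X n)) - integral\<^sup>L M (F t)) /\<^sub>R (X n - t)" for n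
      unfolding Q_def using F[of "X n"] F[OF t] X by simp
    ultimately show "(\<lambda>n. (integral\<^sup>L M (F (X n)) - integral\<^sup>L M (F t)) /\<^sub>R (X n - t))
        \<longlonglongrightarrow> integral\<^sup>L M (F' t)"
      by simp
  qed
  then show "((\<lambda>s. integral\<^sup>L M (F s)) has_vector_derivative integral\<^sup>L M (F' t)) (at t)"
    unfolding has_vector_derivative_iff_quotient using d by (simp add: at_within_open[of t "ball t d"])
qed

section \<open>The integral of a quotient with moving denominator\<close>

text \<open>Both \<open>v\<close> and \<open>c\<close> are Lipschitz with constant \<open>B\<close>,
  uniformly in \<open>l\<close>, so the gap between \<open>c t\<close> and the range of
  \<open>v t\<close> persists for nearby \<open>s\<close>. The integrand and its derivative are then
  bounded by constants, which are integrable for a finite measure. The term with \<open>c' t\<close>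
  is kept apart because its integral is the one fixed by the equation for the eigenvalue.\<close>

lemma (in finite_measure) has_vector_derivative_integral_quotient:
  fixes h v h' v' :: "real \<Rightarrow> 'a \<Rightarrow> real" and c c' :: "real \<Rightarrow> complex"
  assumes d: "0 < d"
    and h: "\<And>s. s \<in> ball t d \<Longrightarrow> h s \<in> borel_measurable M"
      "\<And>s l. s \<in> ball t d \<Longrightarrow> l \<in> space M \<Longrightarrow> ((\<lambda>s. h s l) has_vector_derivative h' s l) (at s)"
      "\<And>s l. s \<in> ball t d \<Longrightarrow> l \<in> space M \<Longrightarrow> \<bar>h s l\<bar> \<le> B"
      "\<And>s l. s \<in> ball t d \<Longrightarrow> l \<in> space M \<Longrightarrow> \<bar>h' s l\<bar> \<le> B"
    and v: "\<And>s. s \<in> ball t d \<Longrightarrow> v s \<in> borel_measurable M"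
      "\<And>s l. s \<in> ball t d \<Longrightarrow> l \<in> space M \<Longrightarrow> ((\<lambda>s. v s l) has_vector_derivative v' s l) (at s)"
      "\<And>s l. s \<in> ball t d \<Longrightarrow> l \<in> space M \<Longrightarrow> \<bar>v' s l\<bar> \<le> B"
    and c: "\<And>s. s \<in> ball t d \<Longrightarrow> (c has_vector_derivative c' s) (at s)"
      "\<And>s. s \<in> ball t d \<Longrightarrow> norm (c' s) \<le> B"
    and sep: "c t \<notin> closure ((\<lambda>l. complex_of_real (v t l)) ` space M)"
  shows "integrable M (h' t)"
    and "((\<lambda>s. integral\<^sup>L M (h s)) has_vector_derivative integral\<^sup>L M (h' t)) (at t)"
    and "integrable M (\<lambda>l. of_real (h' t l) / (of_real (v t l) - c t))"
    and "integrable M (\<lambda>l. of_real (h t l * v' t l) / (of_real (v t l) - c t)\<^sup>2)"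
    and "integrable M (\<lambda>l. of_real (h t l) / (of_real (v t l) - c t)\<^sup>2)"
    and "((\<lambda>s. \<integral>l. of_real (h s l) / (of_real (v s l) - c s) \<partial>M) has_vector_derivative
      (\<integral>l. of_real (h' t l) / (of_real (v t l) - c t) \<partial>M)
      - (\<integral>l. of_real (h t l * v' t l) / (of_real (v t l) - c t)\<^sup>2 \<partial>M)
      + c' t * (\<integral>l. of_real (h t l) / (of_real (v t l) - c t)\<^sup>2 \<partial>M)) (at t)"
proof -
  have t: "t \<in> ball t d"
    using d by simp
  have const: "integrable M (\<lambda>_. b)" for b :: real
    by simp
  have h_int: "integrable M (h s)" if "s \<in> ball t d" for s
    by (rule integrable_const_bound[of _ B]) (use h that in auto)
  note dh = leibniz_rule_dominated[where t = t and w = "\<lambda>_. B", OF d h_int h(2) const]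
  show "integrable M (h' t)"
    using dh(1) h(4) by auto
  then have [measurable]: "h' t \<in> borel_measurable M"
    by auto
  show "((\<lambda>s. integral\<^sup>L M (h s)) has_vector_derivative integral\<^sup>L M (h' t)) (at t)"
    using dh(2) h(4) by auto
  have v_lip: "\<bar>v s l - v t l\<bar> \<le> B * \<bar>s - t\<bar>" if "s \<in> ball t d" "l \<in> space M" for s l
    using norm_diff_le_of_vector_derivative_bound[where S = "ball t d"
        and f = "\<lambda>s. v s l" and f' = "\<lambda>s. v' s l" and B = B and a = t and b = s] that v d by auto
  have c_lip: "norm (c s - c t) \<le> B * \<bar>s - t\<bar>" if "s \<in> ball t d" for s
    using norm_diff_le_of_vector_derivative_bound[where S = "ball t d"
        and f = c and f' = c' and B = B and a = t and b = s] that c d by auto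
  \<comment> \<open>The bound on \<open>c'\<close> is the one that involves no point of
    \<open>space M\<close>, which might be empty.\<close>
  have B: "0 \<le> B"
    using c(2)[OF t] norm_ge_zero order_trans by blast
  obtain \<delta> where \<delta>: "0 < \<delta>" "\<And>l. l \<in> space M \<Longrightarrow> \<delta> \<le> norm (of_real (v t l) - c t)"
    using sep unfolding closure_approachable by (force simp: dist_norm)
  \<comment> \<open>For \<open>s\<close> within \<open>e\<close> of \<open>t\<close>,
    \<open>v\<close> and \<open>c\<close> each move by at most \<delta>/4, which leaves \<delta>/2
    of the gap. The summand 1 keeps the denominator positive when \<open>B = 0\<close>.\<close>
  define e where "e = min d (\<delta> / (4 * (B + 1)))"
  have e: "0 < e" "e \<le> d"
    using d \<delta>(1) B by (auto simp: e_def)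
  have sub: "s \<in> ball t d" if "s \<in> ball t e" for s
    using that e by auto
  have lower: "\<delta> / 2 \<le> norm (of_real (v s l) - c s)" if s: "s \<in> ball t e" and l: "l \<in> space M" for s l
  proof -
    have "\<bar>s - t\<bar> \<le> \<delta> / (4 * (B + 1))"
      using s by (auto simp: e_def dist_real_def)
    then have "(B + 1) * \<bar>s - t\<bar> \<le> \<delta> / 4"
      using B by (simp add: field_simps)
    moreover have "B * \<bar>s - t\<bar> \<le> (B + 1) * \<bar>s - t\<bar>"
      by (rule mult_right_mono) auto
    ultimately have small: "B * \<bar>s - t\<bar> \<le> \<delta> / 4"
      by linarith
    have "complex_of_real (v t l) - c t = (of_real (v s l) - c s) + of_real (v t l - v s l) + (c s - c t)"
      by simp
    then have "norm (complex_of_real (v t l) - c t)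
        \<le> norm (complex_of_real (v s l) - c s) + norm (complex_of_real (v t l - v s l)) + norm (c s - c t)"
      by (metis add_right_mono norm_triangle_ineq norm_triangle_le)
    moreover have "norm (complex_of_real (v t l - v s l)) = \<bar>v s l - v t l\<bar>"
      by (simp only: norm_of_real abs_minus_commute)
    ultimately show ?thesis
      using \<delta>(2)[OF l] v_lip[OF sub[OF s] l] c_lip[OF sub[OF s]] small by linarith
  qed
  have ne: "of_real (v s l) - c s \<noteq> 0" if "s \<in> ball t e" "l \<in> space M" for s l
    using lower[OF that] \<delta>(1) by auto
  define F where "F s l = complex_of_real (h s l) / (of_real (v s l) - c s)" for s l
  define F' where "F' s l = of_real (h' s l) / (of_real (v s l) - c s)
    - of_real (h s l) * (of_real (v' s l) - c' s) / (of_real (v s l) - c s)\<^sup>2" for s l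
  \<comment> \<open>The two summands bound those of \<open>F'\<close>: numerators at most
    \<open>B\<close> and \<open>B * (B + B)\<close>, denominators at least \<delta>/2 and its
    square.\<close>
  define w where "w = B / (\<delta> / 2) + B * (B + B) / (\<delta> / 2)\<^sup>2"
  have F'_deriv: "((\<lambda>s. F s l) has_vector_derivative F' s l) (at s)"
    if s: "s \<in> ball t e" and l: "l \<in> space M" for s l
  proof -
    have 1: "((\<lambda>s. complex_of_real (h s l)) has_vector_derivative of_real (h' s l)) (at s)"
      using h(2)[OF sub[OF s] l]
      by (intro has_vector_derivative_of_real) (simp add: has_real_derivative_iff_has_vector_derivative)
    have "((\<lambda>s. complex_of_real (v s l)) has_vector_derivative of_real (v' s l)) (at s)"
      using v(2)[OF sub[OF s] l]
      by (intro has_vector_derivative_of_real) (simp add: has_real_derivative_iff_has_vector_derivative)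
    then have 2: "((\<lambda>s. of_real (v s l) - c s) has_vector_derivative of_real (v' s l) - c' s) (at s)"
      by (intro has_vector_derivative_diff c(1) sub s)
    \<comment> \<open>The reciprocal is differentiated by the chain rule for a complex
      differentiable function along a curve with real parameter.\<close>
    have "((inverse \<circ> (\<lambda>s. of_real (v s l) - c s)) has_vector_derivative
        (of_real (v' s l) - c' s) * - ((inverse (of_real (v s l) - c s))\<^sup>2)) (at s)"
      using ne[OF s l]
      by (intro field_vector_diff_chain_at[OF 2])
        (auto intro!: derivative_eq_intros simp: power2_eq_square)
    from has_vector_derivative_mult[OF 1 this[unfolded o_def]] show ?thesis
      by (simp add: F_def F'_def field_simps)
  qed
  have q_bound: "norm (a / (of_real (v s l) - c s)) \<le> b / (\<delta> / 2)"
    "norm (a / (of_real (v s l) - c s)\<^sup>2) \<le> b / (\<delta> / 2)\<^sup>2"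
    if "norm a \<le> b" "s \<in> ball t e" "l \<in> space M" for a b s l
    unfolding norm_divide norm_power using that lower[OF that(2,3)] \<delta>(1)
    by (intro frac_le power_mono order_trans[OF norm_ge_zero that(1)]; simp)+
  have F'_bound: "norm (F' s l) \<le> w" if s: "s \<in> ball t e" and l: "l \<in> space M" for s l
  proof -
    have "norm (of_real (v' s l) - c' s) \<le> B + B"
      using v(3)[OF sub[OF s] l] c(2)[OF sub[OF s]] norm_triangle_ineq4[of "complex_of_real (v' s l)" "c' s"]
      by simp
    then have "norm (complex_of_real (h s l) * (of_real (v' s l) - c' s)) \<le> B * (B + B)"
      unfolding norm_mult using h(3)[OF sub[OF s] l] B by (intro mult_mono) auto
    then show ?thesis
      unfolding F'_def w_def using h(4)[OF sub[OF s] l]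
      by (intro order_trans[OF norm_triangle_ineq4] add_mono q_bound s l) auto
  qed
  have t': "t \<in> ball t e"
    using e by simp
  have F_int: "integrable M (F s)" if s: "s \<in> ball t e" for s
  proof (rule integrable_const_bound[of _ "B / (\<delta> / 2)"])
    have [measurable]: "h s \<in> borel_measurable M" "v s \<in> borel_measurable M"
      using h v sub[OF s] by auto
    show "F s \<in> borel_measurable M"
      unfolding F_def by measurable
    show "AE l in M. norm (F s l) \<le> B / (\<delta> / 2)"
      unfolding F_def using h(3)[OF sub[OF s]] by (intro AE_I2 q_bound s) auto
  qed
  have [measurable]: "h t \<in> borel_measurable M" "v t \<in> borel_measurable M"
    using h v t by auto
  \<comment> \<open>Only \<open>v'\<close> is assumed bounded, so \<open>v s\<close> itself need not
    be integrable. Subtracting \<open>v t\<close> gives a bounded function with the same derivative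
    in \<open>s\<close>, and the Leibniz rule then yields measurability of
    \<open>v' t\<close>.\<close>
  have v_int: "integrable M (\<lambda>l. v s l - v t l)" if "s \<in> ball t d" for s
  proof (rule integrable_const_bound[of _ "B * \<bar>s - t\<bar>"])
    show "AE l in M. norm (v s l - v t l) \<le> B * \<bar>s - t\<bar>"
      using v_lip[OF that] by (intro AE_I2) auto
  qed (use v(1)[OF that] in measurable)
  have "integrable M (v' t)"
  proof (rule leibniz_rule_dominated(1)[OF d v_int _ const])
    show "((\<lambda>s. v s l - v t l) has_vector_derivative v' s l) (at s)"
      if "s \<in> ball t d" "l \<in> space M" for s l
      using has_vector_derivative_diff[OF v(2)[OF that] has_vector_derivative_const] by simp
  qed (use v(3) in auto)
  then have [measurable]: "v' t \<in> borel_measurable M"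
    by auto
  show int1: "integrable M (\<lambda>l. of_real (h' t l) / (of_real (v t l) - c t))"
    using h(4)[OF t] by (intro integrable_const_bound[of _ "B / (\<delta> / 2)"] AE_I2 q_bound t') auto
  have "\<bar>h t l * v' t l\<bar> \<le> B * B" if "l \<in> space M" for l
    unfolding abs_mult using h(3)[OF t that] v(3)[OF t that] B by (intro mult_mono) auto
  then show int2: "integrable M (\<lambda>l. of_real (h t l * v' t l) / (of_real (v t l) - c t)\<^sup>2)"
    using t' by (intro integrable_const_bound[of _ "B * B / (\<delta> / 2)\<^sup>2"] AE_I2 q_bound)
      (auto simp del: of_real_mult)
  show int3: "integrable M (\<lambda>l. of_real (h t l) / (of_real (v t l) - c t)\<^sup>2)"
    using h(3)[OF t] by (intro integrable_const_bound[of _ "B / (\<delta> / 2)\<^sup>2"] AE_I2 q_bound t') auto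
  have "F' t = (\<lambda>l. of_real (h' t l) / (of_real (v t l) - c t)
      - of_real (h t l * v' t l) / (of_real (v t l) - c t)\<^sup>2
      + c' t * (of_real (h t l) / (of_real (v t l) - c t)\<^sup>2))"
    by (auto simp: F'_def fun_eq_iff diff_divide_distrib right_diff_distrib mult.commute)
  then have "integral\<^sup>L M (F' t) = (\<integral>l. of_real (h' t l) / (of_real (v t l) - c t) \<partial>M)
      - (\<integral>l. of_real (h t l * v' t l) / (of_real (v t l) - c t)\<^sup>2 \<partial>M)
      + c' t * (\<integral>l. of_real (h t l) / (of_real (v t l) - c t)\<^sup>2 \<partial>M)"
    using int1 int2 int3 by (simp del: of_real_mult times_divide_eq_right)
  with leibniz_rule_dominated(2)[where t = t, OF e(1) F_int F'_deriv const F'_bound]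
  show "((\<lambda>s. \<integral>l. of_real (h s l) / (of_real (v s l) - c s) \<partial>M) has_vector_derivative
      (\<integral>l. of_real (h' t l) / (of_real (v t l) - c t) \<partial>M)
      - (\<integral>l. of_real (h t l * v' t l) / (of_real (v t l) - c t)\<^sup>2 \<partial>M)
      + c' t * (\<integral>l. of_real (h t l) / (of_real (v t l) - c t)\<^sup>2 \<partial>M)) (at t)"
    unfolding F_def by simp
qed

section \<open>Derivatives and local bounds from the regularity assumptions\<close>

lemma C1_strip_derivatives:
  assumes "C1_strip T f" and "t \<in> {0<..<T}"
  shows "((\<lambda>s. f s x) has_vector_derivative vector_derivative (\<lambda>s. f s x) (at t)) (at t)"
    and "((\<lambda>y. f t y) has_vector_derivative vector_derivative (\<lambda>y. f t y) (at x)) (at x)"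
  using assms unfolding C1_strip_def vector_derivative_works by blast+

lemma C1_strip_bounded:
  assumes f: "C1_strip T f" and K: "compact K" "K \<subseteq> {0<..<T} \<times> UNIV"
  obtains B where "\<And>t x. (t, x) \<in> K \<Longrightarrow> norm (vector_derivative (\<lambda>s. f s x) (at t)) \<le> B"
    and "\<And>t x. (t, x) \<in> K \<Longrightarrow> norm (vector_derivative (\<lambda>y. f t y) (at x)) \<le> B"
proof -
  have "bounded ((\<lambda>(t, x). vector_derivative (\<lambda>s. f s x) (at t)) ` K)"
    "bounded ((\<lambda>(t, x). vector_derivative (\<lambda>y. f t y) (at x)) ` K)"
    using f K unfolding C1_strip_def
    by (auto intro!: compact_imp_bounded compact_continuous_image elim: continuous_on_subset)
  then obtain B1 B2 where
    "\<And>t x. (t, x) \<in> K \<Longrightarrow> norm (vector_derivative (\<lambda>s. f s x) (at t)) \<le> B1"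
    "\<And>t x. (t, x) \<in> K \<Longrightarrow> norm (vector_derivative (\<lambda>y. f t y) (at x)) \<le> B2"
    unfolding bounded_iff by fast
  then show thesis
    by (intro that[of "max B1 B2"]) (auto simp: le_max_iff_disj)
qed

lemma regular_field_derivatives:
  assumes "regular_field T f" and "t \<in> {0<..<T}" and "l \<in> I01"
  shows "((\<lambda>s. f s x l) has_vector_derivative deriv (\<lambda>s. f s x l) t) (at t)"
    and "((\<lambda>y. f t y l) has_vector_derivative deriv (\<lambda>y. f t y l) x) (at x)"
  using assms
  unfolding regular_field_def C1_strip_def DERIV_deriv_iff_real_differentiable[symmetric]
    has_real_derivative_iff_has_vector_derivative
  by blast+

lemma regular_field_bounded:
  assumes "regular_field T f" and "compact K" and "K \<subseteq> {0<..<T} \<times> UNIV"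
  obtains B where "\<And>t x l. (t, x) \<in> K \<Longrightarrow> l \<in> I01 \<Longrightarrow> \<bar>f t x l\<bar> \<le> B"
    and "\<And>t x l. (t, x) \<in> K \<Longrightarrow> l \<in> I01 \<Longrightarrow> \<bar>deriv (\<lambda>s. f s x l) t\<bar> \<le> B"
    and "\<And>t x l. (t, x) \<in> K \<Longrightarrow> l \<in> I01 \<Longrightarrow> \<bar>deriv (\<lambda>y. f t y l) x\<bar> \<le> B"
proof -
  obtain B where "\<forall>(t, x)\<in>K. \<forall>l\<in>I01.
      \<bar>f t x l\<bar> \<le> B \<and> \<bar>deriv (\<lambda>s. f s x l) t\<bar> \<le> B \<and> \<bar>deriv (\<lambda>y. f t y l) x\<bar> \<le> B"
    using assms unfolding regular_field_def by meson
  then show thesis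
    by (intro that[of B]) auto
qed

section \<open>The transport equation for the Riemann invariant\<close>

theorem proposition4p12:
  fixes g T :: real
    and H u :: "real \<Rightarrow> real \<Rightarrow> real \<Rightarrow> real"
    and c :: "real \<Rightarrow> real \<Rightarrow> complex"
  assumes "g > 0"
    and "regular_field T H" and "regular_field T u"
    and "solves_system g T H u"
    and "C1_strip T c"
    and "\<And>t x. t \<in> {0<..<T} \<Longrightarrow> c t x \<notin> closure ((\<lambda>l. complex_of_real (u t x l)) ` I01)"
    and "\<And>t x. t \<in> {0<..<T} \<Longrightarrow> c t x \<in> point_spectrum_A0 g (H t x) (u t x)"
    and "\<And>t x. t \<in> {0<..<T} \<Longrightarrow>
           int01 (\<lambda>l. complex_of_real (g * H t x l) / (c t x - complex_of_real (u t x l))\<^sup>2) = 1"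
  shows "generalized_Riemann_invariant T c
           (\<lambda>t x. c t x - complex_of_real g *
              int01 (\<lambda>l. complex_of_real (H t x l) / (complex_of_real (u t x l) - c t x)))"
  unfolding generalized_Riemann_invariant_def
proof (intro ballI allI)
  let ?R = "\<lambda>t x. c t x - complex_of_real g *
    int01 (\<lambda>l. complex_of_real (H t x l) / (complex_of_real (u t x l) - c t x))"
  fix t x :: real
  assume t: "t \<in> {0<..<T}"
  interpret finite_measure "lebesgue_on I01"
    by (rule finite_measure_lebesgue_on) simp
  have space: "space (lebesgue_on I01) = I01"
    by simp
  \<comment> \<open>Half the distance from \<open>t\<close> to the ends of the time interval, so
    that even the closed ball around \<open>t\<close> stays inside. The same radius is used in
    \<open>x\<close>.\<close>
  define d where "d = min t (T - t) / 2"
  have d: "0 < d"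
    using t by (auto simp: d_def)
  define K where "K = cball t d \<times> cball x d"
  have strip: "s \<in> {0<..<T}" if "s \<in> cball t d" for s
  proof -
    have "\<bar>s - t\<bar> \<le> min t (T - t) / 2"
      using that by (simp add: d_def dist_real_def abs_minus_commute)
    then have "\<bar>s - t\<bar> \<le> t / 2" "\<bar>s - t\<bar> \<le> (T - t) / 2"
      by auto
    moreover have "0 < t" "t < T" "s - t \<le> \<bar>s - t\<bar>" "t - s \<le> \<bar>s - t\<bar>"
      using t by auto
    ultimately have "0 < s" "s < T"
      by argo+
    then show ?thesis
      by simp
  qed
  have K: "compact K" "K \<subseteq> {0<..<T} \<times> UNIV"
    using strip by (auto simp: K_def intro!: compact_Times)
  have inK: "(s, x) \<in> K" if "s \<in> ball t d" for s
    using that d by (auto simp: K_def)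
  have inK': "(t, y) \<in> K" if "y \<in> ball x d" for y
    using that d by (auto simp: K_def)
  obtain B1 where B1: "\<And>t x l. (t, x) \<in> K \<Longrightarrow> l \<in> I01 \<Longrightarrow> \<bar>H t x l\<bar> \<le> B1"
    "\<And>t x l. (t, x) \<in> K \<Longrightarrow> l \<in> I01 \<Longrightarrow> \<bar>deriv (\<lambda>s. H s x l) t\<bar> \<le> B1"
    "\<And>t x l. (t, x) \<in> K \<Longrightarrow> l \<in> I01 \<Longrightarrow> \<bar>deriv (\<lambda>y. H t y l) x\<bar> \<le> B1"
    by (rule regular_field_bounded[OF assms(2) K]) (rule that)
  obtain B2 where B2:
    "\<And>t x l. (t, x) \<in> K \<Longrightarrow> l \<in> I01 \<Longrightarrow> \<bar>deriv (\<lambda>s. u s x l) t\<bar> \<le> B2"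
    "\<And>t x l. (t, x) \<in> K \<Longrightarrow> l \<in> I01 \<Longrightarrow> \<bar>deriv (\<lambda>y. u t y l) x\<bar> \<le> B2"
    by (rule regular_field_bounded[OF assms(3) K]) (rule that)
  obtain B3 where B3: "\<And>t x. (t, x) \<in> K \<Longrightarrow> norm (vector_derivative (\<lambda>s. c s x) (at t)) \<le> B3"
    "\<And>t x. (t, x) \<in> K \<Longrightarrow> norm (vector_derivative (\<lambda>y. c t y) (at x)) \<le> B3"
    by (rule C1_strip_bounded[OF assms(5) K]) (rule that)
  \<comment> \<open>The quotient lemma takes a single constant for \<open>H\<close>,
    \<open>u\<close> and \<open>c\<close>.\<close>
  define B where "B = max B1 (max B2 B3)"
  have le_B: "a \<le> B1 \<Longrightarrow> a \<le> B" "a \<le> B2 \<Longrightarrow> a \<le> B" "a \<le> B3 \<Longrightarrow> a \<le> B" for a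
    by (auto simp: B_def)
  have meas: "H s y \<in> borel_measurable (lebesgue_on I01)" "u s y \<in> borel_measurable (lebesgue_on I01)"
    if "s \<in> {0<..<T}" for s y
    using assms(2,3) that by (auto simp: regular_field_def)
  have strip': "s \<in> {0<..<T}" if "s \<in> ball t d" for s
    using strip that by auto
  \<comment> \<open>The quotient lemma is used twice: here in time with \<open>x\<close> frozen,
    then as \<open>dx\<close> in space with \<open>t\<close> frozen. Facts 1 and 2 concern the
    integral of \<open>H\<close>, 3 to 5 are integrability statements, and 6 is the derivative
    formula.\<close>
  note dt = has_vector_derivative_integral_quotient[OF d, where t = t and B = B
      and h = "\<lambda>s. H s x" and h' = "\<lambda>s l. deriv (\<lambda>s. H s x l) s"
      and v = "\<lambda>s. u s x" and v' = "\<lambda>s l. deriv (\<lambda>s. u s x l) s"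
      and c = "\<lambda>s. c s x" and c' = "\<lambda>s. vector_derivative (\<lambda>s. c s x) (at s)", unfolded space,
      OF meas(1)[OF strip'] regular_field_derivatives(1)[OF assms(2) strip']
         le_B(1)[OF B1(1)[OF inK]] le_B(1)[OF B1(2)[OF inK]]
         meas(2)[OF strip'] regular_field_derivatives(1)[OF assms(3) strip'] le_B(2)[OF B2(1)[OF inK]]
         C1_strip_derivatives(1)[OF assms(5) strip'] le_B(3)[OF B3(1)[OF inK]] assms(6)[OF t]]
  note dx = has_vector_derivative_integral_quotient[OF d, where t = x and B = B
      and h = "\<lambda>y. H t y" and h' = "\<lambda>y l. deriv (\<lambda>y. H t y l) y"
      and v = "\<lambda>y. u t y" and v' = "\<lambda>y l. deriv (\<lambda>y. u t y l) y"
      and c = "\<lambda>y. c t y" and c' = "\<lambda>y. vector_derivative (\<lambda>y. c t y) (at y)", unfolded space,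
      OF meas(1)[OF t] regular_field_derivatives(2)[OF assms(2) t]
         le_B(1)[OF B1(1)[OF inK']] le_B(1)[OF B1(3)[OF inK']]
         meas(2)[OF t] regular_field_derivatives(2)[OF assms(3) t] le_B(2)[OF B2(2)[OF inK']]
         C1_strip_derivatives(2)[OF assms(5) t] le_B(3)[OF B3(2)[OF inK']] assms(6)[OF t]]
  define Ht where "Ht l = deriv (\<lambda>s. H s x l) t" for l
  define Hx where "Hx l = deriv (\<lambda>y. H t y l) x" for l
  define ut where "ut l = deriv (\<lambda>s. u s x l) t" for l
  define ux where "ux l = deriv (\<lambda>y. u t y l) x" for l
  define z where "z l = complex_of_real (u t x l) - c t x" for l
  define k where "k = int01 (\<lambda>l. of_real (H t x l) / (z l)\<^sup>2)"
  note folds = Ht_def[symmetric] Hx_def[symmetric] ut_def[symmetric] ux_def[symmetric]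
    z_def[symmetric] k_def[symmetric]
  note dt = dt[unfolded folds]
  note dx = dx[unfolded folds]
  \<comment> \<open>This is the equation for the eigenvalue; the order of the difference is
    immaterial under the square.\<close>
  have gk: "of_real g * k = 1"
  proof -
    have "of_real g * k = int01 (\<lambda>l. of_real g * (of_real (H t x l) / (z l)\<^sup>2))"
      unfolding k_def by (rule integral_mult_right_zero[symmetric])
    also have "\<dots> = int01 (\<lambda>l. complex_of_real (g * H t x l) / (c t x - complex_of_real (u t x l))\<^sup>2)"
      by (simp add: z_def power2_commute)
    also have "\<dots> = 1"
      by (rule assms(8)[OF t])
    finally show ?thesis .
  qed
  \<comment> \<open>The derivative of \<open>c\<close> enters with the factor
    \<open>1 - g k\<close>, which vanishes by \<open>gk\<close>. The statement is generic in order
    to serve both variables.\<close>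
  have R: "((\<lambda>s. f s - of_real g * F s) has_vector_derivative - of_real g * (a - b)) (at s)"
    if "(f has_vector_derivative f') (at s)" "(F has_vector_derivative a - b + f' * k) (at s)"
    for f F :: "real \<Rightarrow> complex" and f' a b s
  proof -
    have "f' - of_real g * (a - b + f' * k) = - of_real g * (a - b) + f' * (1 - of_real g * k)"
      by (simp add: algebra_simps)
    also have "\<dots> = - of_real g * (a - b)"
      using gk by simp
    finally show ?thesis
      using has_vector_derivative_diff[OF that(1)
          has_vector_derivative_mult_right[OF that(2), of "of_real g"]] by simp
  qed
  note Rt = R[OF C1_strip_derivatives(1)[OF assms(5) t] dt(6)]
  note Rx = R[OF C1_strip_derivatives(2)[OF assms(5) t] dx(6)]
  let ?P = "int01 Hx"
  \<comment> \<open>The pressure term of the system differentiates the integral of \<open>H\<close>;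
    moving the derivative inside makes it comparable with the integral of \<open>Hx\<close> that
    arises below.\<close>
  have P: "deriv (\<lambda>y. int01 (H t y)) x = ?P"
    using dx(2) by (intro DERIV_imp_deriv) (simp add: has_real_derivative_iff_has_vector_derivative)
  have Ht: "Ht l = - (Hx l * u t x l + H t x l * ux l)"
    and ut: "ut l = - (u t x l * ux l) - g * ?P" if l: "l \<in> I01" for l
  proof -
    have "((\<lambda>y. H t y l * u t y l) has_real_derivative Hx l * u t x l + ux l * H t x l) (at x)"
      using regular_field_derivatives(2)[OF assms(2) t l] regular_field_derivatives(2)[OF assms(3) t l]
      unfolding Hx_def ux_def
      by (intro DERIV_mult) (simp_all add: has_real_derivative_iff_has_vector_derivative)
    from DERIV_imp_deriv[OF this] have "Ht l + (Hx l * u t x l + ux l * H t x l) = 0"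
      and "ut l + u t x l * ux l + g * ?P = 0"
      using assms(4)[unfolded solves_system_def, rule_format, OF t l, of x]
      unfolding P[symmetric] Ht_def ut_def ux_def by simp_all
    then show "Ht l = - (Hx l * u t x l + H t x l * ux l)" "ut l = - (u t x l * ux l) - g * ?P"
      by (simp_all add: mult.commute)
  qed
  have z: "z l \<noteq> 0" if "l \<in> I01" for l
  proof -
    have "c t x \<notin> (\<lambda>l. complex_of_real (u t x l)) ` I01"
      using assms(6)[OF t] by (rule contra_subsetD[OF closure_subset])
    with that have "c t x \<noteq> of_real (u t x l)"
      by (metis imageI)
    then show ?thesis
      by (simp add: z_def)
  qed
  \<comment> \<open>Here \<open>y\<close> stands for \<open>u - c\<close>, hence
    \<open>v - y\<close> for \<open>c\<close>, and \<open>p\<close> for \<open>g * ?P\<close>. With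
    \<open>w\<close> as the reciprocal of \<open>y\<close>, the claim becomes a polynomial identity
    modulo \<open>y * w = 1\<close>, within reach of \<open>algebra\<close>.\<close>
  have cancel: "- (hx * v + h * vx) / y - h * (- (v * vx) - p) / y\<^sup>2 + (v - y) * (hx / y - h * vx / y\<^sup>2)
      = p * (h / y\<^sup>2) - hx" if "y \<noteq> 0" for hx v h vx p y :: complex
  proof -
    define w where "w = inverse y"
    have "y * w = 1"
      using that by (simp add: w_def)
    then have "- (hx * v + h * vx) * w - h * (- (v * vx) - p) * w\<^sup>2 + (v - y) * (hx * w - h * vx * w\<^sup>2)
        = p * (h * w\<^sup>2) - hx"
      by algebra
    then show ?thesis
      by (simp only: w_def divide_inverse power_inverse)
  qed
  have cancel': "of_real (Ht l) / z l - of_real (H t x l * ut l) / (z l)\<^sup>2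
      + c t x * (of_real (Hx l) / z l - of_real (H t x l * ux l) / (z l)\<^sup>2)
    = of_real (g * ?P) * (of_real (H t x l) / (z l)\<^sup>2) - of_real (Hx l)" if l: "l \<in> I01" for l
  proof -
    have c: "c t x = of_real (u t x l) - z l"
      by (simp add: z_def)
    show ?thesis
      unfolding c Ht[OF l] ut[OF l] of_real_minus of_real_add of_real_diff of_real_mult
      by (rule cancel[OF z[OF l]])
  qed
  let ?a = "int01 (\<lambda>l. of_real (Ht l) / z l)" and ?b = "int01 (\<lambda>l. of_real (H t x l * ut l) / (z l)\<^sup>2)"
    and ?a' = "int01 (\<lambda>l. of_real (Hx l) / z l)" and ?b' = "int01 (\<lambda>l. of_real (H t x l * ux l) / (z l)\<^sup>2)"
  have "?a - ?b + c t x * (?a' - ?b') = int01 (\<lambda>l. of_real (Ht l) / z l - of_real (H t x l * ut l) / (z l)\<^sup>2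
      + c t x * (of_real (Hx l) / z l - of_real (H t x l * ux l) / (z l)\<^sup>2))"
    using dt(3,4) dx(3,4) by (simp del: of_real_mult)
  also have "\<dots> = int01 (\<lambda>l. of_real (g * ?P) * (of_real (H t x l) / (z l)\<^sup>2) - of_real (Hx l))"
    by (rule Bochner_Integration.integral_cong) (use cancel' in auto)
  \<comment> \<open>The pressure contributes \<open>g * ?P * k\<close> and the remaining
    \<open>Hx\<close> contributes \<open>- ?P\<close>; these balance because
    \<open>g k = 1\<close>.\<close>
  also have "\<dots> = of_real (g * ?P) * k - of_real ?P"
    using dx(1,5) unfolding k_def
    by (simp del: of_real_mult times_divide_eq_right)
  also have "\<dots> = of_real ?P * (of_real g * k - 1)"
    by (simp add: algebra_simps)
  finally have sum0: "?a - ?b + c t x * (?a' - ?b') = 0"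
    using gk by simp
  have "- of_real g * (?a - ?b) + c t x * (- of_real g * (?a' - ?b'))
      = - of_real g * (?a - ?b + c t x * (?a' - ?b'))"
    by (simp add: algebra_simps)
  then have "- of_real g * (?a - ?b) + c t x * (- of_real g * (?a' - ?b')) = 0"
    using sum0 by simp
  then have "vector_derivative (\<lambda>s. ?R s x) (at t) + c t x * vector_derivative (\<lambda>y. ?R t y) (at x) = 0"
    by (simp only: vector_derivative_at[OF Rt] vector_derivative_at[OF Rx])
  then show "(\<lambda>s. ?R s x) differentiable (at t) \<and> (\<lambda>y. ?R t y) differentiable (at x) \<and>
      vector_derivative (\<lambda>s. ?R s x) (at t) + c t x * vector_derivative (\<lambda>y. ?R t y) (at x) = 0"
    using differentiableI_vector[OF Rt] differentiableI_vector[OF Rx] by blast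
qed

end
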